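(* Let $(\bar c,\bar b)\in\mathbb{R}^p\times C(T,\mathbb{R})$ and $\bar x\in\mathbb{R}^p$ be such that $\mathcal{S}(\bar c,\bar b)=\{\bar x\}$, and assume that $P(\bar c,\bar b)$ satisfies the Slater condition. Then $$\mathrm{clm}\,\mathcal{S}\big((\bar c,\bar b),\bar x\big)\ \ge\ \mathrm{clm}\,\mathcal{S}_{\bar c}(\bar b,\bar x)\ \ge\ \sup_{D\in\mathcal{K}_{\bar b}(\bar x)}\ \limsup_{\substack{x\to\bar x\\ f_D(x)>0}}\ \frac{1}{d_*\big(0_p,\partial f_D(x)\big)}.$$
   Context: Setting: $T$ is a compact Hausdorff space, $t\mapsto a_t\in\mathbb{R}^p$ is a fixed continuous function on $T$, and $C(T,\mathbb{R})$ is the space of continuous functions $b=(b_t)_{t\in T}$ with $\|b\|_\infty=\max_{t\in T}|b_t|$. $\mathbb{R}^p$ carries an arbitrary norm $\|\cdot\|$ with dual norm $\|u\|_*=\max_{\|x\|\le1}\langle u,x\rangle$; $d_*$ is the distance associated with $\|\cdot\|_*$ (including point-to-set distance), and $0_p$ is the zero vector of $\mathbb{R}^p$. For $(c,b)\in\mathbb{R}^p\times C(T,\mathbb{R})$, $P(c,b)$ is the problem: minimize $\langle c,x\rangle$ subject to $\langle a_t,x\rangle\le b_t$ for all $t\in T$. The parameter space has norm $\|(c,b)\|=\max\{\|c\|_*,\|b\|_\infty\}$. $\mathcal{S}(c,b)\subset\mathbb{R}^p$ is the set of optimal solutions of $P(c,b)$, and for fixed $c$, $\mathcal{S}_c(b):=\mathcal{S}(c,b)$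 as a set-valued mapping of $b\in C(T,\mathbb{R})$. The Slater condition holds for $P(c,b)$ if there is $\hat x\in\mathbb{R}^p$ with $\langle a_t,\hat x\rangle<b_t$ for all $t\in T$. Calmness modulus: for a set-valued mapping $S$ from a metric space $(Y,d_Y)$ to a metric space $(X,d_X)$ and $\bar x\in S(\bar y)$, $\mathrm{clm}\,S(\bar y,\bar x)\in[0,\infty]$ is the infimum of all $\kappa\ge0$ for which there are neighborhoods $U$ of $\bar x$ and $V$ of $\bar y$ with $d_X(x,S(\bar y))\le\kappa\, d_Y(y,\bar y)$ whenever $y\in V$ and $x\in S(y)\cap U$ (it is $+\infty$ if no such $\kappa$ exists). Active indices: $T_b(x)=\{t\in T:\langle a_t,x\rangle=b_t\}$ for feasible $x$. $\mathrm{cone}(X)$ is the conical convex hull of $X$, always containing $0$ (so $\mathrm{cone}(\emptyset)=\{0_p\}$). Define $$\mathcal{K}_{\bar b}(\bar x)=\{D\subset T_{\bar b}(\bar x): |D|\le p,\ -\bar c\in\mathrm{cone}\{a_t: t\in D\}\}.$$ For $D\in\mathcal{K}_{\bar b}(\bar x)$, the convex function $f_D:\mathbb{R}^p\to\mathbb{R}$ is $$f_D(x)=\sup\big\{\langle a_t,x\rangle-\bar b_t,\ t\in T;\ -\langle a_t,x\rangle+\bar b_t,\ t\in D\big\},$$ and $\partial f_D(x)$ is its convex subdifferential. *)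

theory Defs
  imports "HOL-Analysis.Analysis"
begin

text \<open>An arbitrary norm on \<open>\<real>\<^sup>p\<close> is an explicit function \<open>N\<close>, independent of the Euclidean norm carried
  by the type; the inner product \<open>\<bullet>\<close> is always the standard one.\<close>

definition is_norm :: "('v::real_vector \<Rightarrow> real) \<Rightarrow> bool" where
  "is_norm N \<longleftrightarrow> (\<forall>x. 0 \<le> N x) \<and> (\<forall>x. N x = 0 \<longleftrightarrow> x = 0) \<and>
     (\<forall>r x. N (r *\<^sub>R x) = \<bar>r\<bar> * N x) \<and> (\<forall>x y. N (x + y) \<le> N x + N y)"

definition dual_norm :: "('v::real_inner \<Rightarrow> real) \<Rightarrow> 'v \<Rightarrow> real" where
  "dual_norm N u = (SUP x\<in>{x. N x \<le> 1}. u \<bullet> x)"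

text \<open>Extended-real valued, so that the distance to the empty set is \<open>\<infinity>\<close>.\<close>

definition point_dist :: "('x \<Rightarrow> 'x \<Rightarrow> real) \<Rightarrow> 'x \<Rightarrow> 'x set \<Rightarrow> ereal" where
  "point_dist d x A = (INF y\<in>A. ereal (d x y))"

text \<open>Calmness modulus with respect to metrics \<open>dY\<close> and \<open>dX\<close> on the full types; neighbourhoods are
  taken in the topologies induced by these metrics. \<open>Inf {} = \<infinity>\<close> covers the non-calm case.\<close>

definition clm ::
  "('y \<Rightarrow> 'y \<Rightarrow> real) \<Rightarrow> ('x \<Rightarrow> 'x \<Rightarrow> real) \<Rightarrow> ('y \<Rightarrow> 'x set) \<Rightarrow> 'y \<Rightarrow> 'x \<Rightarrow> ereal" where
  "clm dY dX S ybar xbar = Inf {ereal \<kappa> | \<kappa>. 0 \<le> \<kappa> \<and>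
     (\<exists>U V. openin (Metric_space.mtopology UNIV dX) U \<and> xbar \<in> U \<and>
            openin (Metric_space.mtopology UNIV dY) V \<and> ybar \<in> V \<and>
            (\<forall>y\<in>V. \<forall>x\<in>S y \<inter> U. point_dist dX x (S ybar) \<le> ereal (\<kappa> * dY y ybar)))}"

text \<open>Metric of the norm \<open>max {\<parallel>c\<parallel>\<^sub>*, \<parallel>b\<parallel>\<^sub>\<infinity>}\<close>. On a compact space every continuous function is bounded,
  so the type of bounded continuous functions is \<open>C(T,\<real>)\<close> and its \<open>norm\<close> is the maximum norm.\<close>

definition param_dist ::
  "('v::real_inner \<Rightarrow> real) \<Rightarrow> 'v \<times> ('t::topological_space \<Rightarrow>\<^sub>C real) \<Rightarrow> 'v \<times> ('t \<Rightarrow>\<^sub>C real) \<Rightarrow> real" where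
  "param_dist N q r = max (dual_norm N (fst q - fst r)) (norm (snd q - snd r))"

definition feasible :: "('t::topological_space \<Rightarrow> 'v::real_inner) \<Rightarrow> ('t \<Rightarrow>\<^sub>C real) \<Rightarrow> 'v set" where
  "feasible a b = {x. \<forall>t. a t \<bullet> x \<le> apply_bcontfun b t}"

definition opt_set ::
  "('t::topological_space \<Rightarrow> 'v::real_inner) \<Rightarrow> 'v \<times> ('t \<Rightarrow>\<^sub>C real) \<Rightarrow> 'v set" where
  "opt_set a = (\<lambda>(c, b). {x \<in> feasible a b. \<forall>y\<in>feasible a b. c \<bullet> x \<le> c \<bullet> y})"

definition slater :: "('t::topological_space \<Rightarrow> 'v::real_inner) \<Rightarrow> ('t \<Rightarrow>\<^sub>C real) \<Rightarrow> bool" where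
  "slater a b \<longleftrightarrow> (\<exists>x. \<forall>t. a t \<bullet> x < apply_bcontfun b t)"

definition active :: "('t::topological_space \<Rightarrow> 'v::real_inner) \<Rightarrow> ('t \<Rightarrow>\<^sub>C real) \<Rightarrow> 'v \<Rightarrow> 't set" where
  "active a b x = {t. a t \<bullet> x = apply_bcontfun b t}"

text \<open>\<open>convex_cone hull\<close> always contains \<open>0\<close>, also for the empty set (unlike \<open>cone hull\<close>).\<close>

definition KKT_sets ::
  "('t::topological_space \<Rightarrow> real ^ 'p) \<Rightarrow> real ^ 'p \<Rightarrow> ('t \<Rightarrow>\<^sub>C real) \<Rightarrow> real ^ 'p \<Rightarrow> 't set set" where
  "KKT_sets a c b x = {D. D \<subseteq> active a b x \<and> finite D \<and> card D \<le> CARD('p) \<and>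
     - c \<in> convex_cone hull (a ` D)}"

definition f_sup ::
  "('t::topological_space \<Rightarrow> 'v::real_inner) \<Rightarrow> ('t \<Rightarrow>\<^sub>C real) \<Rightarrow> 't set \<Rightarrow> 'v \<Rightarrow> real" where
  "f_sup a b D x = Sup ((\<lambda>t. a t \<bullet> x - apply_bcontfun b t) ` UNIV \<union>
                        (\<lambda>t. - (a t \<bullet> x) + apply_bcontfun b t) ` D)"

definition subdifferential :: "('v::real_inner \<Rightarrow> real) \<Rightarrow> 'v \<Rightarrow> 'v set" where
  "subdifferential f x = {u. \<forall>y. f x + u \<bullet> (y - x) \<le> f y}"

end

theory Submission
  imports Defs
begin

text \<open>For \<open>x\<close> near \<open>xbar\<close> and \<open>\<delta> = f_D(x)\<close>, the function
  \<open>b t = max (a t \<bullet> x) (bbar t - \<delta>)\<close> lies within \<open>\<delta>\<close> of \<open>bbar\<close>; the point \<open>x\<close> is feasible for it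
  with all indices of \<open>D\<close> active, so the KKT condition makes \<open>x\<close> optimal. A calmness constant
  \<open>\<kappa>\<close> of \<open>b \<mapsto> S(c, b)\<close> therefore gives the error bound \<open>N (x - xbar) \<le> \<kappa> * f_D(x)\<close>. As
  \<open>f_D(xbar) \<le> 0\<close>, each subgradient \<open>u\<close> of \<open>f_D\<close> at \<open>x\<close> satisfies
  \<open>f_D(x) \<le> u \<bullet> (x - xbar) \<le> dual_norm N u * N (x - xbar)\<close>, so \<open>1 \<le> \<kappa> * dual_norm N u\<close>.\<close>

subsection \<open>Norms and dual norms\<close>

lemma is_norm_zero: "is_norm N \<Longrightarrow> N 0 = 0"
  unfolding is_norm_def by blast

lemma is_norm_minus_commute:
  assumes "is_norm N"
  shows "N (x - y) = N (y - x)"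
proof -
  have "N ((-1) *\<^sub>R (y - x)) = \<bar>-1\<bar> * N (y - x)"
    using assms unfolding is_norm_def by blast
  then show ?thesis by simp
qed

lemma Metric_space_is_norm:
  assumes "is_norm N"
  shows "Metric_space UNIV (\<lambda>x y. N (x - y))"
proof
  fix x y z
  show "0 \<le> N (x - y)" using assms by (simp add: is_norm_def)
  show "N (x - y) = N (y - x)" by (rule is_norm_minus_commute[OF assms])
  show "N (x - y) = 0 \<longleftrightarrow> x = y" using assms by (simp add: is_norm_def)
  have "N ((x - y) + (y - z)) \<le> N (x - y) + N (y - z)"
    using assms unfolding is_norm_def by blast
  then show "N (x - z) \<le> N (x - y) + N (y - z)" by simp
qed

text \<open>Expanding a vector in the orthonormal basis and applying the triangle inequality bounds
  \<open>N\<close> by the Euclidean norm. The summand 1 in the constant gives strict positivity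
  without inspecting \<open>N\<close> on \<open>Basis\<close>.\<close>

lemma is_norm_le_norm:
  fixes N :: "'v::euclidean_space \<Rightarrow> real"
  assumes "is_norm N"
  obtains C where "C > 0" "\<And>x. N x \<le> C * norm x"
proof
  let ?C = "(\<Sum>i\<in>Basis. N i) + 1"
  have nn: "N y \<ge> 0" for y using assms by (simp add: is_norm_def)
  show "?C > 0" using sum_nonneg[of Basis N] nn by (simp add: add_nonneg_pos)
  fix x
  have sub: "N (\<Sum>i\<in>A. f i) \<le> (\<Sum>i\<in>A. N (f i))" if "finite A" for A :: "'v set" and f
    using that
  proof (induction A)
    case empty
    then show ?case using is_norm_zero[OF assms] by simp
  next
    case (insert i A)
    have "N (f i + sum f A) \<le> N (f i) + N (sum f A)"
      using assms unfolding is_norm_def by blast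
    then show ?case using insert by simp
  qed
  have "N x = N (\<Sum>i\<in>Basis. (x \<bullet> i) *\<^sub>R i)" by (simp add: euclidean_representation)
  also have "\<dots> \<le> (\<Sum>i\<in>Basis. N ((x \<bullet> i) *\<^sub>R i))" by (rule sub) simp
  also have "\<dots> = (\<Sum>i\<in>Basis. \<bar>x \<bullet> i\<bar> * N i)" using assms by (simp add: is_norm_def)
  also have "\<dots> \<le> (\<Sum>i\<in>Basis. norm x * N i)"
    by (intro sum_mono mult_right_mono Basis_le_norm nn)
  also have "\<dots> = norm x * (\<Sum>i\<in>Basis. N i)" by (simp add: sum_distrib_left)
  also have "\<dots> \<le> ?C * norm x" by (simp add: algebra_simps)
  finally show "N x \<le> ?C * norm x" .
qed

text \<open>The preceding bound makes \<open>N\<close> Lipschitz, so \<open>N\<close> attains its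
  minimum on the compact Euclidean unit sphere. That minimum is positive, and homogeneity extends
  the estimate to every vector.\<close>

lemma norm_le_is_norm:
  fixes N :: "'v::euclidean_space \<Rightarrow> real"
  assumes "is_norm N"
  obtains C where "C > 0" "\<And>x. norm x \<le> C * N x"
proof -
  obtain B where B: "B > 0" "\<And>x. N x \<le> B * norm x" using is_norm_le_norm[OF assms] by blast
  have tri: "N x \<le> N y + N (x - y)" for x y
  proof -
    have "N (y + (x - y)) \<le> N y + N (x - y)" using assms unfolding is_norm_def by blast
    then show ?thesis by simp
  qed
  have lip: "B-lipschitz_on UNIV N"
  proof (rule lipschitz_onI)
    fix x y
    have "\<bar>N x - N y\<bar> \<le> N (x - y)"
      using tri[of x y] tri[of y x] is_norm_minus_commute[OF assms, of x y] by linarith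
    then show "dist (N x) (N y) \<le> B * dist x y"
      using B(2)[of "x - y"] by (simp add: dist_norm)
  qed (use B in simp)
  have ne: "sphere (0::'v) 1 \<noteq> {}" by simp
  have "continuous_on (sphere 0 1) N"
    using lipschitz_on_continuous_on[OF lip] by (rule continuous_on_subset) simp
  then obtain z where z: "z \<in> sphere 0 1" "\<And>y. y \<in> sphere 0 1 \<Longrightarrow> N z \<le> N y"
    using continuous_attains_inf[OF compact_sphere ne] by metis
  have "N z \<noteq> 0" "N z \<ge> 0" using z(1) assms by (auto simp: is_norm_def)
  then have pos: "N z > 0" by simp
  show ?thesis
  proof
    show "1 / N z > 0" using pos by simp
    fix x
    show "norm x \<le> 1 / N z * N x"
    proof (cases "x = 0")
      case True
      then show ?thesis using is_norm_zero[OF assms] by simp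
    next
      case False
      have "N z \<le> N ((1 / norm x) *\<^sub>R x)" by (rule z(2)) (use False in simp)
      also have "\<dots> = N x / norm x" using assms by (simp add: is_norm_def)
      finally show ?thesis using pos False by (simp add: field_simps)
    qed
  qed
qed

lemma inner_le_dual_norm:
  fixes N :: "'v::euclidean_space \<Rightarrow> real"
  assumes "is_norm N"
  shows "u \<bullet> x \<le> dual_norm N u * N x"
proof (cases "x = 0")
  case True
  then show ?thesis using is_norm_zero[OF assms] by simp
next
  case False
  then have pos: "N x > 0" using assms by (simp add: is_norm_def less_le)
  obtain C where C: "C > 0" "\<And>x. norm x \<le> C * N x" using norm_le_is_norm[OF assms] by blast
  \<comment> \<open>The real-valued \<open>SUP\<close> dominates its members only when the set is
    bounded above; the unit ball of \<open>N\<close> is Euclidean-bounded, so Cauchy-Schwarz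
    suffices.\<close>
  have "bdd_above ((\<lambda>x. u \<bullet> x) ` {x. N x \<le> 1})"
  proof (rule bdd_aboveI2)
    fix y assume "y \<in> {x. N x \<le> 1}"
    then have "C * N y \<le> C" using C(1) by simp
    then have "norm y \<le> C" using C(2)[of y] by linarith
    then show "u \<bullet> y \<le> norm u * C"
      using norm_cauchy_schwarz[of u y] by (meson order_trans mult_left_mono norm_ge_zero)
  qed
  moreover have "(1 / N x) *\<^sub>R x \<in> {x. N x \<le> 1}" using assms pos by (simp add: is_norm_def)
  ultimately have "u \<bullet> ((1 / N x) *\<^sub>R x) \<le> dual_norm N u"
    unfolding dual_norm_def by (rule cSUP_upper[rotated])
  then show ?thesis using pos by (simp add: field_simps)
qed

text \<open>Together with \<open>inner_le_dual_norm\<close> this characterises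
  \<open>dual_norm N u\<close> as a least constant, so the norm axioms below reduce to pointwise
  inequalities.\<close>

lemma dual_norm_le:
  assumes "is_norm N" "0 \<le> K" "\<And>x. u \<bullet> x \<le> K * N x"
  shows "dual_norm N u \<le> K"
  unfolding dual_norm_def
proof (rule cSUP_least)
  have "0 \<in> {x. N x \<le> 1}" using is_norm_zero[OF assms(1)] by simp
  then show "{x. N x \<le> 1} \<noteq> {}" by blast
  fix x assume "x \<in> {x. N x \<le> 1}"
  then have "K * N x \<le> K" using assms(2) by (simp add: mult_left_le)
  then show "u \<bullet> x \<le> K" using assms(3)[of x] by linarith
qed

lemma is_norm_dual_norm:
  fixes N :: "'v::euclidean_space \<Rightarrow> real"
  assumes "is_norm N"
  shows "is_norm (dual_norm N)"
proof -
  note le = inner_le_dual_norm[OF assms]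
  have nn: "N x \<ge> 0" for x using assms by (simp add: is_norm_def)
  \<comment> \<open>Pairing \<open>u\<close> with itself excludes a vanishing dual norm.\<close>
  have self: "dual_norm N u > 0" if "u \<noteq> 0" for u
  proof -
    have "0 < u \<bullet> u" using that by simp
    also have "\<dots> \<le> dual_norm N u * N u" by (rule le)
    finally show ?thesis using nn[of u] by (simp add: zero_less_mult_iff)
  qed
  have "dual_norm N 0 = (SUP x\<in>{x. N x \<le> 1}. 0)" by (simp add: dual_norm_def)
  also have "\<dots> = 0"
  proof (rule cSUP_const)
    have "N 0 \<le> 1" using is_norm_zero[OF assms] by simp
    then show "{x. N x \<le> 1} \<noteq> {}" by blast
  qed
  finally have zero: "dual_norm N 0 = 0" .
  have dn: "dual_norm N u \<ge> 0" for u using self[of u] zero by (cases "u = 0") auto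
  have scale_le: "dual_norm N (r *\<^sub>R u) \<le> \<bar>r\<bar> * dual_norm N u" for r u
  proof (rule dual_norm_le[OF assms])
    fix x
    have "\<bar>u \<bullet> x\<bar> \<le> dual_norm N u * N x"
      using le[of u x] le[of u "-x"] is_norm_minus_commute[OF assms, of 0 x] by (simp add: abs_le_iff)
    then have "\<bar>r\<bar> * \<bar>u \<bullet> x\<bar> \<le> \<bar>r\<bar> * (dual_norm N u * N x)" by (rule mult_left_mono) simp
    moreover have "r *\<^sub>R u \<bullet> x \<le> \<bar>r\<bar> * \<bar>u \<bullet> x\<bar>" by (simp flip: abs_mult)
    ultimately show "r *\<^sub>R u \<bullet> x \<le> \<bar>r\<bar> * dual_norm N u * N x" by (simp add: mult.assoc)
  qed (simp add: dn)
  have scale: "dual_norm N (r *\<^sub>R u) = \<bar>r\<bar> * dual_norm N u" for r u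
  proof (cases "r = 0")
    case True
    then show ?thesis by (simp add: zero)
  next
    case False
    \<comment> \<open>The reverse inequality is \<open>scale_le\<close> for the factor
      \<open>inverse r\<close>.\<close>
    have "dual_norm N (inverse r *\<^sub>R (r *\<^sub>R u)) \<le> \<bar>inverse r\<bar> * dual_norm N (r *\<^sub>R u)"
      by (rule scale_le)
    then have "\<bar>r\<bar> * dual_norm N u \<le> dual_norm N (r *\<^sub>R u)"
      using False by (simp add: field_simps)
    then show ?thesis using scale_le[of r u] by linarith
  qed
  have "dual_norm N (u + v) \<le> dual_norm N u + dual_norm N v" for u v
  proof (rule dual_norm_le[OF assms])
    show "(u + v) \<bullet> x \<le> (dual_norm N u + dual_norm N v) * N x" for x
      using le[of u x] le[of v x] by (simp add: inner_add_left distrib_right)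
  qed (simp add: dn)
  then show ?thesis
    unfolding is_norm_def using dn scale self zero by (metis less_irrefl)
qed

text \<open>The distance is induced by the norm \<open>M\<close> on the product. Being a metric is
  what gives \<open>mtopology\<close> its description by balls.\<close>

lemma Metric_space_param_dist:
  fixes N :: "'v::euclidean_space \<Rightarrow> real"
  assumes "is_norm N"
  shows "Metric_space UNIV (param_dist N :: 'v \<times> ('t::topological_space \<Rightarrow>\<^sub>C real) \<Rightarrow> _)"
proof -
  define M where "M = (\<lambda>q::'v \<times> ('t \<Rightarrow>\<^sub>C real). max (dual_norm N (fst q)) (norm (snd q)))"
  have D: "dual_norm N u \<ge> 0" "dual_norm N u = 0 \<longleftrightarrow> u = 0"
    "dual_norm N (r *\<^sub>R u) = \<bar>r\<bar> * dual_norm N u"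
    "dual_norm N (u + v) \<le> dual_norm N u + dual_norm N v" for u v r
    using is_norm_dual_norm[OF assms] unfolding is_norm_def by blast+
  have "is_norm M"
    unfolding is_norm_def
  proof (intro conjI allI)
    fix q q' :: "'v \<times> ('t \<Rightarrow>\<^sub>C real)" and r
    show "0 \<le> M q" by (simp add: M_def le_max_iff_disj)
    show "M q = 0 \<longleftrightarrow> q = 0"
      using D(1,2)[of "fst q"] by (auto simp: M_def max_def prod_eq_iff)
    show "M (r *\<^sub>R q) = \<bar>r\<bar> * M q"
      by (simp add: M_def D(3) max_mult_distrib_left)
    show "M (q + q') \<le> M q + M q'"
      using D(4)[of "fst q" "fst q'"] norm_triangle_ineq[of "snd q" "snd q'"]
      unfolding M_def fst_add snd_add by linarith
  qed
  then have "Metric_space UNIV (\<lambda>q r. M (q - r))" by (rule Metric_space_is_norm)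
  moreover have "(\<lambda>q r. M (q - r)) = param_dist N" by (simp add: M_def param_dist_def fun_eq_iff)
  ultimately show ?thesis by simp
qed

subsection \<open>Calmness moduli\<close>

text \<open>Composing with an isometric embedding tests fewer parameters. Preimages of open sets are
  open, since balls of equal radius correspond, so every constant admissible for \<open>S\<close>
  stays admissible and the infimum can only drop.\<close>

lemma clm_le_clm_comp:
  assumes Y: "Metric_space UNIV dY" and Z: "Metric_space UNIV dZ"
    and isom: "\<And>z z'. dY (g z) (g z') = dZ z z'"
  shows "clm dZ dX (\<lambda>z. S (g z)) zbar xbar \<le> clm dY dX S (g zbar) xbar"
  unfolding clm_def
proof (rule Inf_superset_mono, clarify)
  fix \<kappa> U V
  assume \<kappa>: "0 \<le> \<kappa>" and U: "openin (Metric_space.mtopology UNIV dX) U" "xbar \<in> U"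
    and V: "openin (Metric_space.mtopology UNIV dY) V" "g zbar \<in> V"
    and calm: "\<forall>y\<in>V. \<forall>x\<in>S y \<inter> U. point_dist dX x (S (g zbar)) \<le> ereal (\<kappa> * dY y (g zbar))"
  have "openin (Metric_space.mtopology UNIV dZ) {z. g z \<in> V}"
    unfolding Metric_space.openin_mtopology[OF Z]
  proof (intro conjI allI impI)
    fix z assume "z \<in> {z. g z \<in> V}"
    then obtain r where "r > 0" "Metric_space.mball UNIV dY (g z) r \<subseteq> V"
      using V(1) unfolding Metric_space.openin_mtopology[OF Y] by auto
    then show "\<exists>r>0. Metric_space.mball UNIV dZ z r \<subseteq> {z. g z \<in> V}"
      by (auto simp: Metric_space.mball_def[OF Y] Metric_space.mball_def[OF Z] isom subset_iff)
  qed simp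
  moreover have "\<forall>z\<in>{z. g z \<in> V}. \<forall>x\<in>S (g z) \<inter> U.
      point_dist dX x (S (g zbar)) \<le> ereal (\<kappa> * dZ z zbar)"
    using calm by (auto simp flip: isom)
  ultimately show "\<exists>\<kappa>'. ereal \<kappa> = ereal \<kappa>' \<and> 0 \<le> \<kappa>' \<and>
     (\<exists>U V. openin (Metric_space.mtopology UNIV dX) U \<and> xbar \<in> U \<and>
            openin (Metric_space.mtopology UNIV dZ) V \<and> zbar \<in> V \<and>
            (\<forall>y\<in>V. \<forall>x\<in>S (g y) \<inter> U. point_dist dX x (S (g zbar)) \<le> ereal (\<kappa>' * dZ y zbar)))"
    using \<kappa> U V(2) by blast
qed

text \<open>Neighbourhoods in \<open>clm\<close> come from \<open>N\<close>, whereas the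
  \<open>Limsup\<close> uses the topology of the type; this passes from the former to the
  latter.\<close>

lemma openin_norm_metric_eventually:
  fixes N :: "'v::euclidean_space \<Rightarrow> real"
  assumes N: "is_norm N" and "openin (Metric_space.mtopology UNIV (\<lambda>x y. N (x - y))) U" "z \<in> U"
  shows "eventually (\<lambda>x. x \<in> U) (nhds z)"
proof -
  note M = Metric_space_is_norm[OF N]
  obtain r where r: "r > 0" "Metric_space.mball UNIV (\<lambda>x y. N (x - y)) z r \<subseteq> U"
    using assms(2,3) unfolding Metric_space.openin_mtopology[OF M] by auto
  obtain C where C: "C > 0" "\<And>x. N x \<le> C * norm x" using is_norm_le_norm[OF N] by blast
  have "x \<in> U" if "dist x z < r / C" for x
  proof -
    have "N (z - x) \<le> C * dist x z" using C(2)[of "z - x"] by (simp add: dist_norm norm_minus_commute)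
    also have "\<dots> < r" using that C(1) by (simp add: field_simps)
    finally show ?thesis using r(2) by (auto simp: Metric_space.mball_def[OF M])
  qed
  then show ?thesis
    unfolding eventually_nhds_metric using r(1) C(1) by (intro exI[of _ "r / C"]) auto
qed

subsection \<open>The supremum function and its error bound\<close>

text \<open>Boundedness of \<open>a\<close> bounds the family above, so \<open>Sup\<close> is a true
  upper bound. Indices in \<open>D\<close> contribute both signs, hence the absolute value.\<close>

lemma f_sup_upper:
  fixes a :: "'t::topological_space \<Rightarrow> 'v::real_inner"
  assumes "bounded (range a)"
  shows "a t \<bullet> x - apply_bcontfun b t \<le> f_sup a b D x"
    and "t \<in> D \<Longrightarrow> \<bar>a t \<bullet> x - apply_bcontfun b t\<bar> \<le> f_sup a b D x"
proof -
  obtain K where K: "\<And>t. norm (a t) \<le> K" using assms by (auto simp: bounded_iff)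
  have le: "\<bar>a t \<bullet> x - apply_bcontfun b t\<bar> \<le> K * norm x + norm b" for t
  proof -
    have "\<bar>a t \<bullet> x\<bar> \<le> K * norm x"
      using Cauchy_Schwarz_ineq2[of "a t" x] K[of t] by (meson mult_right_mono norm_ge_zero order_trans)
    then show ?thesis using norm_bounded[of b t] by (simp add: real_norm_def)
  qed
  have bdd: "bdd_above ((\<lambda>t. a t \<bullet> x - apply_bcontfun b t) ` UNIV \<union>
                 (\<lambda>t. - (a t \<bullet> x) + apply_bcontfun b t) ` D)" (is "bdd_above ?A")
  proof (rule bdd_aboveI[of _ "K * norm x + norm b"])
    show "s \<le> K * norm x + norm b" if "s \<in> ?A" for s
      using that le by (auto simp: abs_le_iff)
  qed
  show 1: "a t \<bullet> x - apply_bcontfun b t \<le> f_sup a b D x"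
    unfolding f_sup_def by (rule cSup_upper[OF _ bdd]) simp
  show "\<bar>a t \<bullet> x - apply_bcontfun b t\<bar> \<le> f_sup a b D x" if "t \<in> D"
  proof -
    have "- (a t \<bullet> x) + apply_bcontfun b t \<le> f_sup a b D x"
      unfolding f_sup_def by (rule cSup_upper[OF _ bdd]) (use that in auto)
    then show ?thesis using 1 by (simp add: abs_le_iff)
  qed
qed

text \<open>Each function in the family is \<open>K\<close>-Lipschitz and at most 0 at
  \<open>z\<close>: by feasibility for the first kind, by activity for the second.\<close>

lemma f_sup_le:
  fixes a :: "'t::topological_space \<Rightarrow> 'v::real_inner"
  assumes K: "\<And>t. norm (a t) \<le> K" and z: "z \<in> feasible a b" and D: "D \<subseteq> active a b z"
  shows "f_sup a b D x \<le> K * norm (x - z)"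
  unfolding f_sup_def
proof (rule cSup_least)
  have d: "\<bar>a t \<bullet> x - a t \<bullet> z\<bar> \<le> K * norm (x - z)" for t
    using Cauchy_Schwarz_ineq2[of "a t" "x - z"] K[of t]
    by (metis inner_diff_right mult_right_mono norm_ge_zero order_trans)
  fix s
  assume "s \<in> (\<lambda>t. a t \<bullet> x - apply_bcontfun b t) ` UNIV \<union>
              (\<lambda>t. - (a t \<bullet> x) + apply_bcontfun b t) ` D"
  then consider t where "s = a t \<bullet> x - apply_bcontfun b t"
    | t where "t \<in> D" "s = - (a t \<bullet> x) + apply_bcontfun b t" by blast
  then show "s \<le> K * norm (x - z)"
  proof cases
    case (1 t)
    then show ?thesis using d[of t] z by (auto simp: feasible_def abs_le_iff dest: spec[of _ t])
  next
    case (2 t)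
    then have "apply_bcontfun b t = a t \<bullet> z" using D by (auto simp: active_def)
    then show ?thesis using 2 d[of t] by (simp add: abs_le_iff)
  qed
qed simp

text \<open>Moving from \<open>x\<close> to a feasible \<open>y\<close> cannot increase the
  constraints active at \<open>x\<close>. The vectors with nonpositive inner product with
  \<open>y - x\<close> form a convex cone, which therefore contains \<open>- c\<close>.\<close>

lemma opt_set_KKT:
  assumes x: "x \<in> feasible a b" and D: "D \<subseteq> active a b x" and c: "- c \<in> convex_cone hull (a ` D)"
  shows "x \<in> opt_set a (c, b)"
proof -
  have "c \<bullet> x \<le> c \<bullet> y" if y: "y \<in> feasible a b" for y
  proof -
    have "a ` D \<subseteq> {v. v \<bullet> (y - x) \<le> 0}"
      using D y by (auto simp: active_def feasible_def inner_diff_right)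
    moreover have "convex_cone {v. v \<bullet> (y - x) \<le> 0}"
      by (auto simp: convex_cone_iff inner_add_left mult_nonneg_nonpos)
    ultimately have "- c \<in> {v. v \<bullet> (y - x) \<le> 0}" using c hull_minimal by blast
    then show ?thesis by (simp add: inner_diff_right)
  qed
  then show ?thesis using x by (simp add: opt_set_def)
qed

lemma opt_set_perturbation:
  fixes a :: "'t::topological_space \<Rightarrow> 'v::real_inner"
  assumes cont: "continuous_on UNIV a" and bdd: "bounded (range a)"
    and c: "- c \<in> convex_cone hull (a ` D)" and pos: "f_sup a b D x \<ge> 0"
  obtains b' where "dist b' b \<le> f_sup a b D x" "x \<in> opt_set a (c, b')"
proof -
  define \<delta> where "\<delta> = f_sup a b D x"
  define g where "g t = max (a t \<bullet> x) (apply_bcontfun b t - \<delta>)" for t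
  note up = f_sup_upper[OF bdd, where b = b and D = D and x = x, folded \<delta>_def]
  have d0: "\<delta> \<ge> 0" using pos by (simp add: \<delta>_def)
  \<comment> \<open>The first branch of the maximum exceeds \<open>b\<close> by at most
    \<open>\<delta>\<close>, and the second keeps it above \<open>b - \<delta>\<close>.\<close>
  have close: "\<bar>g t - apply_bcontfun b t\<bar> \<le> \<delta>" for t
    using up(1)[of t] d0 by (auto simp: g_def max_def abs_le_iff)
  have "continuous_on UNIV (apply_bcontfun b)"
    using apply_bcontfun[of b] by (simp add: bcontfun_def)
  then have "continuous_on UNIV g"
    unfolding g_def by (intro continuous_intros cont)
  moreover have "bounded (range g)"
    unfolding bounded_iff
  proof (intro exI ballI)
    fix s assume "s \<in> range g"
    then obtain t where "s = g t" by blast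
    then show "norm s \<le> norm b + \<delta>"
      using close[of t] norm_bounded[of b t] by (simp add: real_norm_def)
  qed
  ultimately have "g \<in> bcontfun" by (simp add: bcontfun_def)
  then have g: "apply_bcontfun (Bcontfun g) = g" by (rule Bcontfun_inverse)
  show ?thesis
  proof
    show "dist (Bcontfun g) b \<le> f_sup a b D x"
      unfolding \<delta>_def[symmetric]
      by (rule dist_bound) (simp add: g close dist_real_def)
    show "x \<in> opt_set a (c, Bcontfun g)"
    proof (rule opt_set_KKT[OF _ _ c])
      show "x \<in> feasible a (Bcontfun g)" by (simp add: feasible_def g g_def)
      \<comment> \<open>For \<open>t\<close> in \<open>D\<close> the reversed inequality puts
        \<open>a t \<bullet> x\<close> above \<open>b t - \<delta>\<close>, so the maximum equals
        \<open>a t \<bullet> x\<close>.\<close>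
      show "D \<subseteq> active a (Bcontfun g) x"
        using up(2) by (fastforce simp: active_def g g_def max_def abs_le_iff)
    qed
  qed
qed

text \<open>The subgradient inequality is tested at \<open>z\<close>, and the error bound lets the
  positive factor \<open>f x\<close> cancel. An empty subdifferential is covered, its distance being
  infinite.\<close>

lemma point_dist_subdifferential_ge:
  fixes N :: "'v::euclidean_space \<Rightarrow> real"
  assumes N: "is_norm N" and pos: "f x > 0" and z: "f z \<le> 0" and \<kappa>: "\<kappa> > 0"
    and err: "N (x - z) \<le> \<kappa> * f x"
  shows "ereal (1 / \<kappa>) \<le> point_dist (\<lambda>u v. dual_norm N (u - v)) 0 (subdifferential f x)"
  unfolding point_dist_def
proof (rule INF_greatest)
  fix u assume "u \<in> subdifferential f x"
  then have "f x + u \<bullet> (z - x) \<le> f z" by (simp add: subdifferential_def)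
  then have "f x \<le> u \<bullet> (x - z)" using z by (simp add: inner_diff_right)
  also have "\<dots> \<le> dual_norm N u * N (x - z)" by (rule inner_le_dual_norm[OF N])
  also have "\<dots> \<le> dual_norm N u * (\<kappa> * f x)"
    using is_norm_dual_norm[OF N] by (intro mult_left_mono err) (simp add: is_norm_def)
  finally have "1 \<le> dual_norm N u * \<kappa>" using pos by (simp add: mult.assoc[symmetric])
  then have "1 / \<kappa> \<le> dual_norm N u" using \<kappa> by (simp add: field_simps)
  then show "ereal (1 / \<kappa>) \<le> ereal (dual_norm N (0 - u))"
    using is_norm_minus_commute[OF is_norm_dual_norm[OF N], of 0 u] by simp
qed

text \<open>The distance may be infinite, in which case its reciprocal is 0; the lower bound
  excludes negative values and 0.\<close>

lemma ereal_one_divide_le: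
  assumes "\<kappa> > 0" "ereal (1 / \<kappa>) \<le> d"
  shows "1 / d \<le> ereal \<kappa>"
proof (cases d)
  case (real r)
  then have "1 / \<kappa> \<le> r" using assms(2) by simp
  then have "r > 0" using assms(1) by (meson divide_pos_pos less_le_trans zero_less_one)
  then show ?thesis
    using \<open>1 / \<kappa> \<le> r\<close> real assms(1) by (simp add: one_ereal_def field_simps)
qed (use assms in auto)

theorem theorem6:
  fixes a :: "'t::t2_space \<Rightarrow> real ^ 'p"
    and N :: "real ^ 'p \<Rightarrow> real"
    and cbar xbar :: "real ^ 'p"
    and bbar :: "'t \<Rightarrow>\<^sub>C real"
  assumes "compact (UNIV :: 't set)"
    and "continuous_on UNIV a"
    and "is_norm N"
    and "opt_set a (cbar, bbar) = {xbar}"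
    and "slater a bbar"
  shows "clm (param_dist N) (\<lambda>x y. N (x - y)) (opt_set a) (cbar, bbar) xbar
           \<ge> clm dist (\<lambda>x y. N (x - y)) (\<lambda>b. opt_set a (cbar, b)) bbar xbar
       \<and> clm dist (\<lambda>x y. N (x - y)) (\<lambda>b. opt_set a (cbar, b)) bbar xbar
           \<ge> (SUP D\<in>KKT_sets a cbar bbar xbar.
                Limsup (at xbar within {x. f_sup a bbar D x > 0})
                  (\<lambda>x. 1 / point_dist (\<lambda>u v. dual_norm N (u - v)) 0
                         (subdifferential (f_sup a bbar D) x)))"
proof
  note N = assms(3)
  have Mdist: "Metric_space UNIV (dist :: ('t \<Rightarrow>\<^sub>C real) \<Rightarrow> _)"
    by unfold_locales (auto simp: dist_commute dist_triangle)
  \<comment> \<open>With the first component fixed the maximum reduces to the norm on the right-hand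
    sides, so \<open>Pair cbar\<close> is an isometry.\<close>
  have "param_dist N (cbar, b) (cbar, b') = dist b b'" for b b' :: "'t \<Rightarrow>\<^sub>C real"
    using is_norm_zero[OF is_norm_dual_norm[OF N]] by (simp add: param_dist_def dist_norm)
  then show "clm (param_dist N) (\<lambda>x y. N (x - y)) (opt_set a) (cbar, bbar) xbar
           \<ge> clm dist (\<lambda>x y. N (x - y)) (\<lambda>b. opt_set a (cbar, b)) bbar xbar"
    by (rule clm_le_clm_comp[OF Metric_space_param_dist[OF N] Mdist, where g = "Pair cbar"])
  \<comment> \<open>Compactness makes the suprema in \<open>f_sup\<close> finite and supplies the
    common Lipschitz constant \<open>K\<close>.\<close>
  have bdd: "bounded (range a)"
    using compact_continuous_image[OF assms(2,1)] by (rule compact_imp_bounded)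
  then obtain K where K: "\<And>t. norm (a t) \<le> K" by (auto simp: bounded_iff)
  have xbar: "xbar \<in> feasible a bbar" using assms(4) by (auto simp: opt_set_def)
  show "clm dist (\<lambda>x y. N (x - y)) (\<lambda>b. opt_set a (cbar, b)) bbar xbar
           \<ge> (SUP D\<in>KKT_sets a cbar bbar xbar.
                Limsup (at xbar within {x. f_sup a bbar D x > 0})
                  (\<lambda>x. 1 / point_dist (\<lambda>u v. dual_norm N (u - v)) 0
                         (subdifferential (f_sup a bbar D) x)))"
    unfolding clm_def
  proof (intro SUP_least Inf_greatest, clarify)
    fix D \<kappa> U V
    assume D: "D \<in> KKT_sets a cbar bbar xbar" and "0 \<le> \<kappa>"
      and U: "openin (Metric_space.mtopology UNIV (\<lambda>x y. N (x - y))) U" "xbar \<in> U"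
      and V: "openin (Metric_space.mtopology UNIV dist) V" "bbar \<in> V"
      and calm: "\<forall>b\<in>V. \<forall>x\<in>opt_set a (cbar, b) \<inter> U.
        point_dist (\<lambda>x y. N (x - y)) x (opt_set a (cbar, bbar)) \<le> ereal (\<kappa> * dist b bbar)"
    let ?f = "f_sup a bbar D"
    have act: "D \<subseteq> active a bbar xbar" and cone: "- cbar \<in> convex_cone hull (a ` D)"
      using D by (auto simp: KKT_sets_def)
    note le = f_sup_le[OF K xbar act]
    have f0: "?f xbar \<le> 0" using le[of xbar] by simp
    obtain r where r: "r > 0" "\<And>b. dist b bbar < r \<Longrightarrow> b \<in> V"
      using V unfolding Metric_space.openin_mtopology[OF Mdist]
      by (auto simp: Metric_space.mball_def[OF Mdist] subset_iff dist_commute)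
    \<comment> \<open>Since \<open>f_D(x)\<close> is at most \<open>K * norm (x - xbar)\<close>,
      keeping this below \<open>r\<close> forces the perturbed right-hand side into
      \<open>V\<close>.\<close>
    have "((\<lambda>x. K * norm (x - xbar)) \<longlongrightarrow> K * norm (xbar - xbar)) (nhds xbar)"
      by (intro tendsto_intros filterlim_ident)
    then have "eventually (\<lambda>x. K * norm (x - xbar) < r) (nhds xbar)"
      by (rule order_tendstoD) (use r in simp)
    moreover have "eventually (\<lambda>x. x \<in> U) (nhds xbar)"
      by (rule openin_norm_metric_eventually[OF N U])
    ultimately have ev: "eventually (\<lambda>x. ?f x > 0 \<longrightarrow> N (x - xbar) \<le> \<kappa> * ?f x) (nhds xbar)"
    proof eventually_elim
      case (elim x)
      show ?case
      proof
        assume "?f x > 0"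
        then obtain b where b: "dist b bbar \<le> ?f x" "x \<in> opt_set a (cbar, b)"
          using opt_set_perturbation[OF assms(2) bdd cone] by (metis less_imp_le)
        have "b \<in> V" using r(2) b(1) le[of x] elim by simp
        \<comment> \<open>The solution set at \<open>bbar\<close> is a singleton, so the distance to
          it is \<open>N (x - xbar)\<close>.\<close>
        then have "N (x - xbar) \<le> \<kappa> * dist b bbar"
          using calm b(2) elim assms(4) by (simp add: point_dist_def)
        also have "\<dots> \<le> \<kappa> * ?f x" using b(1) \<open>0 \<le> \<kappa>\<close> by (rule mult_left_mono)
        finally show "N (x - xbar) \<le> \<kappa> * ?f x" .
      qed
    qed
    show "Limsup (at xbar within {x. ?f x > 0})
            (\<lambda>x. 1 / point_dist (\<lambda>u v. dual_norm N (u - v)) 0 (subdifferential ?f x)) \<le> ereal \<kappa>"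
    \<comment> \<open>If \<open>xbar\<close> is not a limit point of the set where
      \<open>f_D\<close> is positive, the filter is trivial and the bound is vacuous.\<close>
    proof (rule Limsup_bounded, unfold eventually_at_filter, rule eventually_mono[OF ev], intro impI)
      fix x assume err: "?f x > 0 \<longrightarrow> N (x - xbar) \<le> \<kappa> * ?f x"
        and "x \<noteq> xbar" and "x \<in> {x. ?f x > 0}"
      then have pos: "?f x > 0" by simp
      \<comment> \<open>Admissibility gives only \<open>0 \<le> \<kappa>\<close>; the error bound at
        a point other than \<open>xbar\<close> makes \<open>\<kappa>\<close> positive, as taking
        reciprocals requires.\<close>
      have "N (x - xbar) > 0" using \<open>x \<noteq> xbar\<close> N by (simp add: is_norm_def less_le)
      then have "\<kappa> * ?f x > 0" using err pos by simp
      then have "\<kappa> > 0" using pos by (simp add: zero_less_mult_iff)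
      then show "1 / point_dist (\<lambda>u v. dual_norm N (u - v)) 0 (subdifferential ?f x) \<le> ereal \<kappa>"
        using ereal_one_divide_le point_dist_subdifferential_ge[OF N pos f0] err pos by blast
    qed
  qed
qed

end
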